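(* Let $m\ge1$, $n=2m$, $q=2^m$, let $\omega$ be a primitive element of $\mathbb{F}_{q^2}$ and $u=\omega^{(q-1)(2^{n-1}-1)}$ (a generator of $\mu_{q+1}$). Let $c\in\mathbb{F}_q^*$, and let $a_i\in\mathbb{F}_{q^2}$ and integers $0\le s_i\le q$ ($i\in\mathbb{Z}_{q+1}$) satisfy $a_iu^{i(1-2s_i)}+a_i^qu^{i(2s_i-1)}=c$ for all $i\in\mathbb{Z}_{q+1}$. Define $f(0)=0$ and $f(x)={\rm Tr}_1^n(a_ix^{s_i(q-1)+1})$ if $x\in u^i\mathbb{F}_q^*$, $i\in\mathbb{Z}_{q+1}$. Then $f$ is bent and its dual is $\widetilde f(x)={\rm Tr}_1^m(c^{-2}x^{q+1})+1$.
   Context: ${\rm Tr}_1^k$ is the absolute trace of $\mathbb{F}_{2^k}$, $\mu_e=\{x:x^e=1\}$. Walsh transform $\widehat f(b)=\sum_x(-1)^{f(x)+{\rm Tr}_1^n(bx)}$; bent iff $|\widehat f(b)|=2^{n/2}$ for all $b$; dual defined by $\widehat f(b)=2^{n/2}(-1)^{\widetilde f(b)}$. *)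

theory Defs
  imports
    Complex_Main
    "HOL-Computational_Algebra.Computational_Algebra"
    "HOL-Number_Theory.Number_Theory"
    "HOL-Library.Z2"
    "HOL-Library.Cardinality"
begin

text \<open>
  The field with \<open>2^n\<close> elements is a type of class \<open>finite_field\<close> of that cardinality, and the
  values of Boolean functions lie in the prime field \<open>bit\<close>, embedded into it by \<open>of_bit\<close>.
\<close>

text \<open>
  \<open>GF2 k\<close> is the subfield with \<open>2^k\<close> elements when \<open>k\<close> divides \<open>n\<close>; for \<open>n = 2k\<close>, which is
  the case of interest, see \<open>subfield_eq_GF2\<close> and \<open>card_GF2\<close>.
\<close>

definition GF2 :: "nat \<Rightarrow> 'a::finite_field set" where
  "GF2 k = {x. x ^ (2 ^ k) = x}"

definition mu :: "nat \<Rightarrow> 'a::finite_field set" where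
  "mu e = {x. x ^ e = 1}"

definition primitive_elem :: "'a::finite_field \<Rightarrow> bool" where
  "primitive_elem w \<longleftrightarrow> range (\<lambda>k::nat. w ^ k) = UNIV - {0}"

text \<open>
  For \<open>x\<close> outside \<open>GF2 k\<close> the sum need not lie in the prime field, and then the value is
  unspecified; \<open>of_bit_abs_trace\<close> covers the arguments for which the trace is defined.
\<close>

definition abs_trace :: "nat \<Rightarrow> 'a::finite_field \<Rightarrow> bit" where
  "abs_trace k x = (THE t. of_bit t = (\<Sum>j<k. x ^ (2 ^ j)))"

definition chi :: "bit \<Rightarrow> real" where
  "chi t = (- 1) ^ (of_bit t :: nat)"

definition walsh :: "nat \<Rightarrow> ('a::finite_field \<Rightarrow> bit) \<Rightarrow> 'a \<Rightarrow> real" where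
  "walsh n f b = (\<Sum>x\<in>UNIV. chi (f x + abs_trace n (b * x)))"

definition bent :: "nat \<Rightarrow> ('a::finite_field \<Rightarrow> bit) \<Rightarrow> bool" where
  "bent n f \<longleftrightarrow> (\<forall>b. \<bar>walsh n f b\<bar> = 2 powr (n / 2))"

text \<open>Meaningful for bent \<open>f\<close> only; see \<open>walsh_bent_dual\<close>.\<close>

definition bent_dual :: "nat \<Rightarrow> ('a::finite_field \<Rightarrow> bit) \<Rightarrow> 'a \<Rightarrow> bit" where
  "bent_dual n f b = (THE t. walsh n f b = 2 powr (n / 2) * chi t)"

lemma walsh_bent_dual:
  assumes "bent n f"
  shows "walsh n f b = 2 powr (n / 2) * chi (bent_dual n f b)"
proof -
  have *: "chi s = chi t \<longleftrightarrow> s = t" for s t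
    by (cases s; cases t) (auto simp: chi_def)
  have "\<bar>walsh n f b\<bar> = 2 powr (n / 2)"
    using assms by (auto simp: bent_def)
  then have "walsh n f b = 2 powr (n / 2) * chi 0 \<or> walsh n f b = 2 powr (n / 2) * chi 1"
    by (auto simp: chi_def abs_if split: if_splits)
  then have "\<exists>!t. walsh n f b = 2 powr (n / 2) * chi t"
    by (auto simp: *)
  then show ?thesis
    unfolding bent_dual_def by (rule theI')
qed

lemma CHAR_2:
  assumes "CARD('a::finite_field) = 2 ^ n"
  shows "CHAR('a) = 2"
proof -
  have "prime CHAR('a)"
    using prime_CHAR_semidom[where ?'a='a] CHAR_pos by blast
  moreover have "CHAR('a) dvd 2 ^ n"
    using CHAR_dvd_CARD[where ?'a='a] assms by simp
  ultimately show ?thesis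
    by (metis prime_dvd_power primes_dvd_imp_eq two_is_prime_nat)
qed

lemma of_bit_abs_trace:
  fixes x :: "'a::finite_field"
  assumes "CARD('a) = 2 ^ n" and "x \<in> GF2 k"
  shows "of_bit (abs_trace k x) = (\<Sum>j<k. x ^ (2 ^ j))"
proof -
  have char: "prime CHAR('a)" "CHAR('a) = 2"
    using CHAR_2[OF assms(1)] by auto
  let ?S = "\<Sum>j<k. x ^ (2 ^ j)"
  have "?S ^ 2 = (\<Sum>j<k. (x ^ (2 ^ j)) ^ 2)"
    using freshmans_dream_sum[OF char(1), of 2] char(2) by auto
  also have "\<dots> = (\<Sum>j<k. x ^ (2 ^ Suc j))"
    by (simp flip: power_mult add: mult.commute)
  also have "\<dots> = ?S"
  proof -
    have "(\<Sum>j<Suc k. x ^ (2 ^ j)) = x + (\<Sum>j<k. x ^ (2 ^ Suc j))"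
      by (subst sum.lessThan_Suc_shift) simp
    moreover have "(\<Sum>j<Suc k. x ^ (2 ^ j)) = ?S + x"
      using assms(2) by (simp add: GF2_def)
    ultimately show ?thesis by (simp add: add.commute)
  qed
  finally have "?S * (?S - 1) = 0"
    by (simp add: power2_eq_square algebra_simps)
  then have "?S = of_bit 0 \<or> ?S = of_bit 1"
    by auto
  then obtain t where t: "of_bit t = ?S"
    by metis
  have "s = t" if "of_bit s = ?S" for s
  proof -
    have "of_bit s = (of_bit t :: 'a)"
      using that t by (rule trans[OF _ sym])
    then show ?thesis
      by (cases s; cases t) auto
  qed
  with t have "\<exists>!t. of_bit t = ?S"
    by blast
  then show ?thesis
    unfolding abs_trace_def by (rule theI')
qed

lemma card_GF2_le:
  assumes "k > 0"
  shows "card (GF2 k :: 'a::finite_field set) \<le> 2 ^ k"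
proof -
  let ?p = "Polynomial.monom 1 (2 ^ k) - Polynomial.monom 1 1 :: 'a poly"
  have k: "(2::nat) ^ k > 1"
    using assms by (intro one_less_power) auto
  have "Polynomial.coeff ?p (2 ^ k) = 1"
    using k by (simp add: Polynomial.coeff_monom)
  then have "?p \<noteq> 0"
    by (metis Polynomial.coeff_0 zero_neq_one)
  then have "card {x. poly ?p x = 0} \<le> Polynomial.degree ?p"
    by (rule card_poly_roots_bound)
  also have "\<dots> \<le> 2 ^ k"
    using k by (intro Polynomial.degree_diff_le) (auto intro: order_trans[OF Polynomial.degree_monom_le])
  also have "{x. poly ?p x = 0} = GF2 k"
    by (simp add: GF2_def Polynomial.poly_monom)
  finally show ?thesis .
qed

lemma subfield_eq_GF2:
  fixes K :: "'a::finite_field set"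
  assumes "k > 0" and "0 \<in> K" and "card K = 2 ^ k"
    and mult: "\<And>x y. x \<in> K \<Longrightarrow> y \<in> K \<Longrightarrow> x * y \<in> K"
  shows "K = GF2 k"
proof -
  have "K \<subseteq> GF2 k"
  proof
    fix x assume x: "x \<in> K"
    show "x \<in> GF2 k"
    proof (cases "x = 0")
      case True
      then show ?thesis by (simp add: GF2_def)
    next
      case False
      let ?K = "K - {0}"
      have inj: "inj_on ((*) x) ?K"
        using False by (auto simp: inj_on_def)
      have "(*) x ` ?K = ?K"
        using inj x False mult by (intro endo_inj_surj) auto
      then have "\<Prod>?K = (\<Prod>y\<in>?K. x * y)"
        using prod.reindex[OF inj, of id] by simp
      also have "\<dots> = x ^ card ?K * \<Prod>?K"
        by (simp add: prod.distrib)
      finally have "x ^ card ?K = 1"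
        by simp
      moreover have "card ?K = 2 ^ k - 1"
        using assms(2,3) by simp
      ultimately have "x ^ Suc (2 ^ k - 1) = x"
        by (simp only: power_Suc mult_1_right)
      moreover have "Suc (2 ^ k - 1) = 2 ^ k"
        by simp
      ultimately show ?thesis
        by (simp only: GF2_def mem_Collect_eq)
    qed
  qed
  then show ?thesis
    using card_GF2_le[OF assms(1), where ?'a='a] assms(3) by (intro card_seteq) auto
qed

lemma card_GF2:
  assumes "k > 0" and card: "CARD('a::finite_field) = 2 ^ (2 * k)"
  shows "card (GF2 k :: 'a set) = 2 ^ k"
proof -
  have char: "prime CHAR('a)" "(2::nat) ^ k = CHAR('a) ^ k"
    using CHAR_2[OF card] by auto
  let ?q = "(2::nat) ^ k"
  define L where "L x = x ^ ?q + x" for x :: 'a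
  have two: "x + x = 0" for x :: 'a
  proof -
    have "of_nat 2 = (0::'a)"
      using CHAR_2[OF card] by (metis of_nat_CHAR)
    then have "(1::'a) + 1 = 0"
      by simp
    then show ?thesis
      by (metis mult_2 mult_zero_left one_add_one)
  qed
  have add: "(x + y) ^ ?q = x ^ ?q + y ^ ?q" for x y :: 'a
    by (rule freshmans_dream'[OF char])
  have frob2: "(x ^ ?q) ^ ?q = x" for x :: 'a
    using finite_field_power_card_eq_same[of x] card
    by (simp flip: power_mult power_add add: mult_2)
  have img: "L ` UNIV \<subseteq> GF2 k"
    by (auto simp: L_def GF2_def add frob2 add.commute)
  have fib: "card (L -` {y}) \<le> card (GF2 k :: 'a set)" for y
  proof (cases "L -` {y} = {}")
    case False
    then obtain x0 where x0: "L x0 = y" by auto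
    have "(\<lambda>x. x + x0) ` (L -` {y}) \<subseteq> GF2 k"
    proof clarify
      fix x assume "y = L x"
      with x0 have "L x + L x0 = 0" by (simp add: two)
      then have "(x ^ ?q + x0 ^ ?q) + (x + x0) = 0"
        by (simp add: L_def algebra_simps)
      then have "(x + x0) ^ ?q = x + x0"
        by (metis add add_right_cancel two)
      then show "x + x0 \<in> GF2 k" by (simp add: GF2_def)
    qed
    then show ?thesis
      by (intro card_inj_on_le[of "\<lambda>x. x + x0"]) auto
  qed simp
  have "?q * ?q = card (\<Union>y\<in>GF2 k. L -` {y} :: 'a set)"
  proof -
    have "(\<Union>y\<in>GF2 k. L -` {y}) = UNIV"
      using img by auto
    then show ?thesis
      using card by (simp add: mult_2 power_add)
  qed
  also have "\<dots> \<le> (\<Sum>y\<in>(GF2 k :: 'a set). card (L -` {y}))"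
    by (rule card_UN_le) simp
  also have "\<dots> \<le> card (GF2 k :: 'a set) * card (GF2 k :: 'a set)"
    using sum_bounded_above[of "GF2 k :: 'a set" "\<lambda>y. card (L -` {y})", OF fib] by simp
  finally have "?q \<le> card (GF2 k :: 'a set)"
    by (meson mult_strict_mono' not_le zero_le)
  then show ?thesis
    using card_GF2_le[OF assms(1), where ?'a='a] by simp
qed

end

theory Submission
  imports Defs
begin

text \<open>
  Write \<open>x \<noteq> 0\<close> uniquely as \<open>v * y\<close> with \<open>v\<close> in \<open>mu (q + 1)\<close> and \<open>y\<close> in the subfield of order
  \<open>q\<close>. The condition on \<open>a i\<close> says exactly that \<open>f (v * y)\<close> is the trace of \<open>c * y\<close>, independently
  of \<open>v\<close>. Summing over \<open>y\<close> first, the Walsh transform at \<open>b\<close> becomes \<open>q * (N - 1)\<close>, where \<open>N\<close> is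
  the number of \<open>v\<close> with \<open>b * v + (b * v) ^ q = c\<close>. Substituting \<open>z = b * v / c\<close> turns
  this into \<open>z ^ q + z = 1\<close>, \<open>z ^ 2 + z = d\<close> with \<open>d = b ^ (q + 1) / c ^ 2\<close>. Every solution \<open>z\<close> of
  the second equation has \<open>z ^ q + z\<close> equal to the trace of \<open>d\<close>, so \<open>N\<close> is 2 or 0 according to
  that trace.
\<close>

section \<open>Characteristic two\<close>

lemma add_self_CHAR_2:
  fixes x :: "'a::finite_field"
  assumes "CHAR('a) = 2"
  shows "x + x = 0"
proof -
  have "of_nat 2 = (0::'a)"
    using assms by (metis of_nat_CHAR)
  then have "(1::'a) + 1 = 0"
    by simp
  then show ?thesis
    by (metis mult_2 mult_zero_left one_add_one)
qed

lemma add_eq_0_iff_CHAR_2: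
  fixes x y :: "'a::finite_field"
  assumes "CHAR('a) = 2"
  shows "x + y = 0 \<longleftrightarrow> x = y"
  by (metis add_self_CHAR_2[OF assms] add_left_cancel)

lemma frobenius_add_CHAR_2:
  fixes x y :: "'a::finite_field"
  assumes "CHAR('a) = 2"
  shows "(x + y) ^ 2 ^ k = x ^ 2 ^ k + y ^ 2 ^ k"
  using freshmans_dream'[of "2 ^ k" k x y] prime_CHAR_semidom[where ?'a='a] assms by simp

lemma power2_eq_iff_CHAR_2:
  fixes x y :: "'a::finite_field"
  assumes "CHAR('a) = 2"
  shows "x\<^sup>2 = y\<^sup>2 \<longleftrightarrow> x = y"
proof
  assume "x\<^sup>2 = y\<^sup>2"
  then have "(x + y)\<^sup>2 = 0"
    using frobenius_add_CHAR_2[OF assms, of x y 1] add_self_CHAR_2[OF assms] by simp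
  then show "x = y"
    by (simp add: add_eq_0_iff_CHAR_2[OF assms])
qed simp

lemma of_bit_add_CHAR_2:
  assumes "CHAR('a::finite_field) = 2"
  shows "(of_bit (s + t) :: 'a) = of_bit s + of_bit t"
  by (cases s; cases t) (use add_self_CHAR_2[OF assms, of 1] in auto)

text \<open>The trace becomes a sum of powers only after embedding by \<open>of_bit\<close>; this
  injectivity carries identities proved in the field back to \<open>bit\<close>.\<close>

lemma of_bit_eq_iff: "(of_bit s :: 'a::zero_neq_one) = of_bit t \<longleftrightarrow> s = t"
  by (cases s; cases t) auto

lemma chi_add: "chi (s + t) = chi s * chi t"
  by (cases s; cases t) (auto simp: chi_def)

lemma chi_simps [simp]: "chi 0 = 1" "chi 1 = -1"
  by (auto simp: chi_def)

lemma chi_eq_iff: "chi s = chi t \<longleftrightarrow> s = t"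
  by (cases s; cases t) auto

section \<open>The subfields and their traces\<close>

lemma GF2_0 [simp]: "0 \<in> GF2 k"
  by (simp add: GF2_def)

lemma GF2_1 [simp]: "1 \<in> GF2 k"
  by (simp add: GF2_def)

lemma GF2_mult: "x \<in> GF2 k \<Longrightarrow> y \<in> GF2 k \<Longrightarrow> x * y \<in> GF2 k"
  by (simp add: GF2_def power_mult_distrib)

lemma GF2_power: "x \<in> GF2 k \<Longrightarrow> x ^ j \<in> GF2 k"
  by (induction j) (auto intro: GF2_mult)

lemma GF2_divide: "x \<in> GF2 k \<Longrightarrow> y \<in> GF2 k \<Longrightarrow> x / y \<in> GF2 k"
  by (simp add: GF2_def power_divide)

lemma GF2_add:
  fixes x y :: "'a::finite_field"
  assumes "CHAR('a) = 2" and "x \<in> GF2 k" and "y \<in> GF2 k"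
  shows "x + y \<in> GF2 k"
  using assms by (simp add: GF2_def frobenius_add_CHAR_2)

lemma GF2_eq_UNIV:
  assumes "CARD('a::finite_field) = 2 ^ n"
  shows "GF2 n = (UNIV :: 'a set)"
  using finite_field_power_card_eq_same[where ?'a='a] assms by (auto simp: GF2_def)

lemma frobenius_conjugate:
  fixes x :: "'a::finite_field"
  assumes "CARD('a) = 2 ^ (2 * m)"
  shows "(x ^ 2 ^ m) ^ 2 ^ m = x"
  using finite_field_power_card_eq_same[of x] assms
  by (simp flip: power_mult power_add add: mult_2)

lemma abs_trace_add:
  fixes x y :: "'a::finite_field"
  assumes card: "CARD('a) = 2 ^ n" and x: "x \<in> GF2 k" and y: "y \<in> GF2 k"
  shows "abs_trace k (x + y) = abs_trace k x + abs_trace k y"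
proof -
  note char = CHAR_2[OF card]
  have "(of_bit (abs_trace k (x + y)) :: 'a) = of_bit (abs_trace k x + abs_trace k y)"
    unfolding of_bit_add_CHAR_2[OF char] of_bit_abs_trace[OF card x] of_bit_abs_trace[OF card y]
      of_bit_abs_trace[OF card GF2_add[OF char x y]] frobenius_add_CHAR_2[OF char] sum.distrib ..
  then show ?thesis by (simp only: of_bit_eq_iff)
qed

lemma abs_trace_0:
  assumes "CARD('a::finite_field) = 2 ^ n"
  shows "abs_trace k (0::'a) = 0"
proof -
  have "(of_bit (abs_trace k (0::'a)) :: 'a) = of_bit 0"
    unfolding of_bit_abs_trace[OF assms GF2_0] by (simp add: power_0_left)
  then show ?thesis
    unfolding of_bit_eq_iff .
qed

text \<open>Transitivity of the trace: in the sum of length \<open>2 * m\<close>, the terms with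
  exponents \<open>m + j\<close> are the conjugates of the first \<open>m\<close> terms.\<close>

lemma abs_trace_tower:
  fixes x :: "'a::finite_field"
  assumes card: "CARD('a) = 2 ^ (2 * m)"
  shows "x + x ^ 2 ^ m \<in> GF2 m" and "abs_trace (2 * m) x = abs_trace m (x + x ^ 2 ^ m)"
proof -
  note char = CHAR_2[OF card]
  show mem: "x + x ^ 2 ^ m \<in> GF2 m"
    by (simp add: GF2_def frobenius_add_CHAR_2[OF char] frobenius_conjugate[OF card] add.commute)
  have x: "x \<in> GF2 (2 * m)"
    using GF2_eq_UNIV[OF card] by auto
  have split: "(\<Sum>j<m + l. x ^ 2 ^ j) = (\<Sum>j<m. x ^ 2 ^ j) + (\<Sum>j<l. x ^ 2 ^ (m + j))" for l
    by (induction l) (simp_all add: add.assoc)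
  have "(of_bit (abs_trace (2 * m) x) :: 'a) = (\<Sum>j<m + m. x ^ 2 ^ j)"
    using of_bit_abs_trace[OF card x] by (simp add: mult_2)
  also have "\<dots> = (\<Sum>j<m. x ^ 2 ^ j) + (\<Sum>j<m. x ^ 2 ^ (m + j))"
    by (rule split)
  also have "\<dots> = (\<Sum>j<m. (x + x ^ 2 ^ m) ^ 2 ^ j)"
    by (simp add: frobenius_add_CHAR_2[OF char] sum.distrib power_add power_mult)
  also have "\<dots> = of_bit (abs_trace m (x + x ^ 2 ^ m))"
    by (rule of_bit_abs_trace[OF card mem, symmetric])
  finally show "abs_trace (2 * m) x = abs_trace m (x + x ^ 2 ^ m)"
    by (simp only: of_bit_eq_iff)
qed

text \<open>The trace is a nonzero polynomial of degree at most 2^(k-1), too small to vanish at 2^k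
  points. With the cardinality as a hypothesis, the whole field is covered as well as
  \<open>GF2 m\<close>.\<close>

lemma abs_trace_surj:
  assumes card: "CARD('a::finite_field) = 2 ^ n" and k: "k > 0" "card (GF2 k :: 'a set) = 2 ^ k"
  shows "\<exists>y\<in>GF2 k. abs_trace k (y::'a) = 1"
proof (rule ccontr)
  assume *: "\<not> (\<exists>y\<in>GF2 k. abs_trace k (y::'a) = 1)"
  have tr: "abs_trace k y = 0" if "y \<in> GF2 k" for y :: 'a
    using that * by (cases "abs_trace k y") auto
  let ?p = "\<Sum>j<k. Polynomial.monom 1 (2 ^ j) :: 'a poly"
  \<comment> \<open>Only \<open>j = 0\<close> contributes to the linear coefficient, which shows
    that \<open>?p\<close> is nonzero.\<close>
  have "Polynomial.coeff ?p 1 = (\<Sum>j<k. if j = 0 then 1 else 0)"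
    unfolding Polynomial.coeff_sum by (intro sum.cong) (auto simp: Polynomial.coeff_monom)
  then have "Polynomial.coeff ?p 1 = 1"
    using k by simp
  then have "?p \<noteq> 0"
    by (metis Polynomial.coeff_0 zero_neq_one)
  then have "card {x. poly ?p x = 0} \<le> Polynomial.degree ?p"
    by (rule card_poly_roots_bound)
  also have "\<dots> \<le> 2 ^ (k - 1)"
    by (intro Polynomial.degree_sum_le)
      (auto intro!: order_trans[OF Polynomial.degree_monom_le] power_increasing)
  also have "\<dots> < (2::nat) ^ k"
    using k by simp
  finally have "card {x. poly ?p x = 0} < card (GF2 k :: 'a set)"
    using k by simp
  moreover have "poly ?p y = 0" if "y \<in> GF2 k" for y
    using of_bit_abs_trace[OF card that] tr[OF that] by (simp add: poly_sum Polynomial.poly_monom)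
  then have "card (GF2 k :: 'a set) \<le> card {x. poly ?p x = 0}"
    by (intro card_mono) auto
  ultimately show False by simp
qed

text \<open>Orthogonality of characters: for nonzero \<open>e\<close>, translation by some
  \<open>y0\<close> with \<open>e * y0\<close> of trace 1 permutes \<open>GF2 k\<close> and flips
  the sign of every term.\<close>

lemma sum_chi_abs_trace:
  fixes e :: "'a::finite_field"
  assumes card: "CARD('a) = 2 ^ n" and k: "k > 0" "card (GF2 k :: 'a set) = 2 ^ k"
    and e: "e \<in> GF2 k"
  shows "(\<Sum>y\<in>GF2 k. chi (abs_trace k (e * y))) = (if e = 0 then 2 ^ k else 0)"
proof (cases "e = 0")
  case True
  then show ?thesis
    using k by (simp add: abs_trace_0[OF card])
next
  case False
  note char = CHAR_2[OF card]
  obtain t :: 'a where t: "t \<in> GF2 k" "abs_trace k t = 1"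
    using abs_trace_surj[OF card k] by blast
  define y0 where "y0 = t / e"
  have y0: "y0 \<in> GF2 k" "e * y0 = t"
    using t e False by (auto simp: y0_def intro: GF2_divide)
  let ?S = "\<Sum>y\<in>GF2 k. chi (abs_trace k (e * y))"
  have cancel: "y + y0 + y0 = y" for y
    by (simp add: add.assoc add_self_CHAR_2[OF char])
  have "?S = (\<Sum>y\<in>GF2 k. chi (abs_trace k (e * (y + y0))))"
    by (rule sum.reindex_bij_witness[of _ "\<lambda>y. y + y0" "\<lambda>y. y + y0"])
      (auto simp: cancel y0 intro: GF2_add[OF char])
  also have "\<dots> = (\<Sum>y\<in>GF2 k. - chi (abs_trace k (e * y)))"
    by (intro sum.cong)
      (auto simp: distrib_left y0 t abs_trace_add[OF card] GF2_mult[OF e] chi_add)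
  also have "\<dots> = - ?S"
    by (simp add: sum_negf)
  finally show ?thesis
    using False by simp
qed

section \<open>Artin--Schreier equations\<close>

text \<open>The trace sum telescopes, its terms being z^(2^(j+1)) + z^(2^j). Only z^2 + z is assumed
  to lie in \<open>GF2 k\<close>; its trace decides whether z does.\<close>

lemma power_add_self_eq_abs_trace:
  fixes z :: "'a::finite_field"
  assumes card: "CARD('a) = 2 ^ n" and d: "z\<^sup>2 + z \<in> GF2 k"
  shows "z ^ 2 ^ k + z = of_bit (abs_trace k (z\<^sup>2 + z))"
proof -
  note char = CHAR_2[OF card]
  have "(\<Sum>j<k. (z\<^sup>2 + z) ^ 2 ^ j) = z ^ 2 ^ k + z"
  proof (induction k)
    case (Suc k)
    have "(\<Sum>j<Suc k. (z\<^sup>2 + z) ^ 2 ^ j) = z ^ 2 ^ Suc k + (z ^ 2 ^ k + z ^ 2 ^ k) + z"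
      using Suc by (simp add: frobenius_add_CHAR_2[OF char] power_mult add_ac)
    then show ?case
      by (simp only: add_self_CHAR_2[OF char] add_0_right)
  qed (simp add: add_self_CHAR_2[OF char])
  then show ?thesis
    using of_bit_abs_trace[OF card d] by simp
qed

text \<open>The map z -> z^2 + z is additive with kernel {0, 1}.\<close>

lemma artin_schreier_eq_iff:
  fixes z w :: "'a::finite_field"
  assumes char: "CHAR('a) = 2"
  shows "z\<^sup>2 + z = w\<^sup>2 + w \<longleftrightarrow> z = w \<or> z = w + 1"
proof -
  have "z\<^sup>2 + z = w\<^sup>2 + w \<longleftrightarrow> (z\<^sup>2 + z) + (w\<^sup>2 + w) = 0"
    by (rule add_eq_0_iff_CHAR_2[OF char, symmetric])
  also have "(z\<^sup>2 + z) + (w\<^sup>2 + w) = (z + w)\<^sup>2 + (z + w)"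
    using frobenius_add_CHAR_2[OF char, of z w 1] by simp
  also have "\<dots> = (z + w) * (z + (w + 1))"
    by (simp add: power2_eq_square algebra_simps)
  finally show ?thesis
    by (simp add: add_eq_0_iff_CHAR_2[OF char])
qed

text \<open>Additive Hilbert 90 by counting: the image of z -> z^2 + z lies in the trace-zero
  elements, which are half of the field, and fibres of size at most 2 make the image at least as
  large.\<close>

lemma artin_schreier_solution:
  fixes d :: "'a::finite_field"
  assumes card: "CARD('a) = 2 ^ n" and n: "n > 0" and d: "abs_trace n d = 0"
  obtains z where "z\<^sup>2 + z = d"
proof -
  note char = CHAR_2[OF card]
  note univ = GF2_eq_UNIV[OF card]
  define L where "L z = z\<^sup>2 + z" for z :: 'a
  let ?K = "{d :: 'a. abs_trace n d = 0}"
  have sub: "range L \<subseteq> ?K"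
  proof clarify
    fix z
    have "(of_bit (abs_trace n (L z)) :: 'a) = z ^ 2 ^ n + z"
      using power_add_self_eq_abs_trace[OF card, of z n] univ by (simp add: L_def)
    also have "\<dots> = of_bit 0"
      using finite_field_power_card_eq_same[of z] card add_self_CHAR_2[OF char] by simp
    finally show "abs_trace n (L z) = 0"
      by (simp only: of_bit_eq_iff)
  qed
  \<comment> \<open>This sum is the number of elements of trace 0 minus the number of elements of
    trace 1.\<close>
  have "(\<Sum>y\<in>UNIV. chi (abs_trace n (y::'a))) = 0"
    using sum_chi_abs_trace[OF card n, of 1] univ card by simp
  moreover have "chi t = 2 * of_bool (t = 0) - 1" for t
    by (cases t) auto
  ultimately have "2 * card ?K = CARD('a)"
    by (simp add: sum_subtractf sum_distrib_left[symmetric] of_nat_eq_iff[where ?'a=real, symmetric]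
        del: of_nat_eq_iff)
  moreover have "CARD('a) \<le> card (range L) * 2"
  proof -
    have "card (L -` {y}) \<le> 2" for y
    proof (cases "L -` {y} = {}")
      case False
      then obtain w where "L w = y" by auto
      then have "L -` {y} \<subseteq> {w, w + 1}"
        using artin_schreier_eq_iff[OF char] by (auto simp: L_def)
      then have "card (L -` {y}) \<le> card {w, w + 1}"
        by (intro card_mono) auto
      also have "\<dots> \<le> 2"
        by (simp add: card_insert_if)
      finally show ?thesis .
    qed simp
    then have "(\<Sum>y\<in>range L. card (L -` {y})) \<le> card (range L) * 2"
      using sum_bounded_above[of "range L" "\<lambda>y. card (L -` {y})" 2] by simp
    moreover have "card (\<Union>y\<in>range L. L -` {y}) \<le> (\<Sum>y\<in>range L. card (L -` {y}))"
      by (rule card_UN_le) simp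
    moreover have "(\<Union>y\<in>range L. L -` {y}) = UNIV"
      by auto
    ultimately show ?thesis by simp
  qed
  ultimately have "range L = ?K"
    using sub by (intro card_seteq) auto
  then have "d \<in> range L"
    using d by simp
  then show ?thesis
    using that by (auto simp: L_def)
qed

text \<open>Solutions of the quadratic always exist in the large field, since d + d^q = d + d = 0.
  Both of them have z^q + z equal to the trace of \<open>d\<close>, so both qualify or neither
  does.\<close>

lemma card_artin_schreier_conjugate:
  fixes d :: "'a::finite_field"
  assumes card: "CARD('a) = 2 ^ (2 * m)" and m: "m > 0" and d: "d \<in> GF2 m"
  shows "card {z. z ^ 2 ^ m + z = 1 \<and> z\<^sup>2 + z = d} = (if abs_trace m d = 1 then 2 else 0)"
proof -
  note char = CHAR_2[OF card]
  have conj: "z ^ 2 ^ m + z = of_bit (abs_trace m d)" if "z\<^sup>2 + z = d" for z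
    using power_add_self_eq_abs_trace[OF card, of z m] that d by simp
  have "abs_trace (2 * m) d = 0"
    using abs_trace_tower(2)[OF card, of d] d
    by (simp add: GF2_def add_self_CHAR_2[OF char] abs_trace_0[OF card])
  then obtain w where w: "w\<^sup>2 + w = d"
    using artin_schreier_solution[OF card] m by auto
  show ?thesis
  proof (cases "abs_trace m d = 1")
    case True
    then have "{z. z ^ 2 ^ m + z = 1 \<and> z\<^sup>2 + z = d} = {w, w + 1}"
      using conj w artin_schreier_eq_iff[OF char, of _ w] by auto
    then show ?thesis
      using True by simp
  next
    case False
    then have "abs_trace m d = 0"
      by (simp add: bit_not_one_iff)
    then have "{z. z ^ 2 ^ m + z = 1 \<and> z\<^sup>2 + z = d} = {}"
      using conj by auto
    then show ?thesis
      using False by (simp only: card.empty if_False)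
  qed
qed

section \<open>Polar decomposition\<close>

text \<open>
  Raising to the power \<open>2 ^ (2 * m - 1)\<close> extracts square roots, so the polar factors of \<open>x\<close> are
  the square roots of \<open>x / x ^ q\<close> and \<open>x ^ q * x\<close>.
\<close>

lemma polar_bij:
  assumes card: "CARD('a::finite_field) = 2 ^ (2 * m)" and m: "m > 0"
  shows "bij_betw (\<lambda>(v, y). v * y) (mu (2 ^ m + 1) \<times> (GF2 m - {0})) (UNIV - {0 :: 'a})"
proof -
  note char = CHAR_2[OF card]
  let ?q = "2 ^ m :: nat" and ?h = "2 ^ (2 * m - 1) :: nat"
  have "v = v' \<and> y = y'"
    if mu: "v \<in> mu (?q + 1)" "v' \<in> mu (?q + 1)"
      and y: "y \<in> GF2 m" "y \<noteq> 0" "y' \<in> GF2 m" and eq: "v * y = v' * y'" for v y v' y' :: 'a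
  proof -
    \<comment> \<open>The norm removes the factor in \<open>mu\<close> and squares the other one;
      squaring is injective.\<close>
    have norm: "(v * y) ^ (?q + 1) = y\<^sup>2" if "v \<in> mu (?q + 1)" "y \<in> GF2 m" for v y :: 'a
      using that by (simp add: mu_def GF2_def power_mult_distrib power2_eq_square)
    have "y\<^sup>2 = y'\<^sup>2"
      using norm[OF mu(1) y(1)] norm[OF mu(2) y(3)] eq by simp
    then have "y = y'"
      by (simp add: power2_eq_iff_CHAR_2[OF char])
    then show ?thesis
      using eq y by simp
  qed
  then have inj: "inj_on (\<lambda>(v, y). v * y) (mu (?q + 1) \<times> (GF2 m - {0 :: 'a}))"
    by (auto simp: inj_on_def)
  have "x \<in> (\<lambda>(v, y). v * y) ` (mu (?q + 1) \<times> (GF2 m - {0}))" if "x \<noteq> 0" for x :: 'a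
  proof (rule image_eqI)
    let ?v = "(x / x ^ ?q) ^ ?h" and ?y = "(x ^ ?q * x) ^ ?h"
    have two: "2 * ?h = 2 ^ (2 * m)"
      using m by (simp flip: power_Suc)
    have "?v * ?y = (x\<^sup>2) ^ ?h"
      using that by (simp add: power_mult_distrib[symmetric] power2_eq_square)
    also have "\<dots> = x"
      using finite_field_power_card_eq_same[of x] card two by (simp flip: power_mult)
    finally show "x = (case (?v, ?y) of (v, y) \<Rightarrow> v * y)"
      by simp
    have "(x / x ^ ?q) ^ (?q + 1) = 1"
      using that by (simp add: power_divide frobenius_conjugate[OF card])
    then have "?v \<in> mu (?q + 1)"
      unfolding mu_def mem_Collect_eq by (metis power_one power_mult mult.commute)
    moreover have "x ^ ?q * x \<in> GF2 m"
      by (simp add: GF2_def power_mult_distrib frobenius_conjugate[OF card])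
    then have "?y \<in> GF2 m"
      by (rule GF2_power)
    ultimately show "(?v, ?y) \<in> mu (?q + 1) \<times> (GF2 m - {0})"
      using that by simp
  qed
  moreover have "v * y \<noteq> 0" if "v \<in> mu (?q + 1)" "y \<noteq> 0" for v y :: 'a
    using that by (auto simp: mu_def)
  ultimately have "(\<lambda>(v, y). v * y) ` (mu (?q + 1) \<times> (GF2 m - {0 :: 'a})) = UNIV - {0}"
    by auto
  with inj show ?thesis
    by (simp add: bij_betw_def)
qed

text \<open>Counting both sides of the polar decomposition gives |mu| (q - 1) = q^2 - 1.\<close>

lemma card_mu:
  assumes card: "CARD('a::finite_field) = 2 ^ (2 * m)" and m: "m > 0"
  shows "card (mu (2 ^ m + 1) :: 'a set) = 2 ^ m + 1"
proof -
  let ?q = "2 ^ m :: nat"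
  have q: "?q > 1"
    using m by (intro one_less_power) auto
  have "card (mu (?q + 1) :: 'a set) * (?q - 1) = ?q * ?q - 1"
    using bij_betw_same_card[OF polar_bij[OF card m]] card card_GF2[OF m card]
    by (simp add: card_cartesian_product mult_2 power_add)
  also have "\<dots> = (?q + 1) * (?q - 1)"
    by (simp add: algebra_simps)
  finally show ?thesis
    using q by (simp only: mult_cancel2) linarith
qed

text \<open>
  The exponent in \<open>u\<close> amounts to \<open>-1/2\<close> modulo \<open>q + 1\<close>: with \<open>g = \<omega> ^ (q - 1)\<close> one has
  \<open>g * u\<^sup>2 = 1\<close>, while \<open>x ^ (q - 1) * x\<^sup>2 = 1\<close> on \<open>mu (q + 1)\<close>.
\<close>

lemma range_power_eq_mu:
  fixes \<omega> u :: "'a::finite_field"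
  assumes card: "CARD('a) = 2 ^ (2 * m)" and m: "m > 0" and \<omega>: "primitive_elem \<omega>"
    and u: "u = \<omega> ^ ((2 ^ m - 1) * (2 ^ (2 * m - 1) - 1))"
  shows "mu (2 ^ m + 1) = range (\<lambda>k::nat. u ^ k)"
proof -
  note char = CHAR_2[OF card]
  let ?q = "2 ^ m :: nat" and ?g = "\<omega> ^ (2 ^ m - 1)"
  have range: "range (\<lambda>k::nat. \<omega> ^ k) = UNIV - {0}"
    using \<omega> by (simp add: primitive_elem_def)
  have \<omega>0: "\<omega> \<noteq> 0"
    using range by (metis DiffE power_one_right rangeI singletonI)
  have "\<omega> * \<omega> ^ (2 ^ (2 * m) - 1) = \<omega> ^ 2 ^ (2 * m)"
    by (subst power_Suc[symmetric]) simp
  then have \<omega>1: "\<omega> ^ (2 ^ (2 * m) - 1) = 1"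
    using finite_field_power_card_eq_same[of \<omega>] card \<omega>0 by simp
  have "(?q - 1) * (?q + 1) = 2 ^ (2 * m) - 1"
    by (simp add: algebra_simps mult_2 mult_2_right power_add)
  then have g1: "?g ^ (?q + 1) = 1"
    using \<omega>1 by (simp only: flip: power_mult)
  have "u = ?g ^ (2 ^ (2 * m - 1) - 1)"
    by (simp add: u power_mult)
  \<comment> \<open>Hence g * u^2 is g raised to q^2 - 1, the order of the multiplicative
    group.\<close>
  moreover have "1 + (2 ^ (2 * m - 1) - 1) * 2 = (2 ^ (2 * m) - 1 :: nat)"
  proof -
    have "2 ^ (2 * m) = 2 * (2::nat) ^ (2 * m - 1)"
      using m by (simp flip: power_Suc)
    moreover have "(2::nat) ^ (2 * m - 1) \<ge> 1"
      by simp
    ultimately show ?thesis by linarith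
  qed
  ultimately have "?g * u\<^sup>2 = ?g ^ (2 ^ (2 * m) - 1)"
    by (metis power_add power_mult power_one_right)
  also have "\<dots> = 1"
    using \<omega>1 by (metis power_mult power_one mult.commute)
  finally have gu: "?g * u\<^sup>2 = 1" .
  have "u ^ (?q + 1) = 1"
    unfolding \<open>u = ?g ^ _\<close> using g1 by (metis power_mult power_one mult.commute)
  then have "u ^ k \<in> mu (?q + 1)" for k
    unfolding mu_def mem_Collect_eq by (metis power_mult power_one mult.commute)
  moreover have "x \<in> range (\<lambda>k::nat. u ^ k)" if "x \<in> mu (?q + 1)" for x
  proof -
    from that have x: "x ^ (?q + 1) = 1" "x \<noteq> 0"
      by (auto simp: mu_def)
    then obtain k where k: "x = \<omega> ^ k"
      using range by (metis DiffI UNIV_I imageE singletonD)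
    \<comment> \<open>Here \<open>?g ^ k\<close> equals x^(q-1). Cancelling it leaves x^2 = (u^k)^2,
      so the exponent of \<open>x\<close> to base \<omega> also serves for base
      \<open>u\<close>.\<close>
    have "?g ^ k * x\<^sup>2 = x ^ (?q - 1) * x\<^sup>2"
      unfolding k by (simp flip: power_mult add: mult.commute)
    also have "\<dots> = x ^ (?q + 1)"
      by (simp flip: power_add)
    also have "\<dots> = (?g * u\<^sup>2) ^ k"
      using x gu by simp
    also have "\<dots> = ?g ^ k * (u ^ k)\<^sup>2"
      by (simp add: power_mult_distrib power_mult[symmetric] mult.commute)
    finally have "x\<^sup>2 = (u ^ k)\<^sup>2"
      using \<omega>0 by simp
    then show ?thesis
      by (simp add: power2_eq_iff_CHAR_2[OF char])
  qed
  ultimately show ?thesis by auto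
qed

section \<open>The Walsh transform\<close>

text \<open>The point 0 contributes 1, and each of the q + 1 punctured lines contributes q - 1 or
  -1, so the total is 1 + q N - (q + 1).\<close>

lemma walsh_polar:
  fixes f :: "'a::finite_field \<Rightarrow> bit"
  assumes card: "CARD('a) = 2 ^ (2 * m)" and m: "m > 0" and c: "c \<in> GF2 m"
    and f0: "f 0 = 0"
    and f: "\<And>v y. v \<in> mu (2 ^ m + 1) \<Longrightarrow> y \<in> GF2 m - {0} \<Longrightarrow> f (v * y) = abs_trace m (c * y)"
  shows "walsh (2 * m) f b =
    2 ^ m * (real (card {v \<in> mu (2 ^ m + 1). b * v + (b * v) ^ 2 ^ m = c}) - 1)"
proof -
  note char = CHAR_2[OF card]
  let ?M = "mu (2 ^ m + 1) :: 'a set" and ?F = "\<lambda>x. chi (f x + abs_trace (2 * m) (b * x))"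
  \<comment> \<open>On the line through \<open>v\<close> the summand is the character y ->
    chi(Tr(\<open>e v\<close> * y)), which is trivial exactly when \<open>v\<close> is counted in
    N.\<close>
  define e where "e v = c + (b * v + (b * v) ^ 2 ^ m)" for v
  have e: "e v \<in> GF2 m" for v
    unfolding e_def by (intro GF2_add[OF char] c abs_trace_tower(1)[OF card])
  have F: "?F (v * y) = chi (abs_trace m (e v * y))" if "v \<in> ?M" "y \<in> GF2 m - {0}" for v y
  proof -
    have y: "y \<in> GF2 m" using that by simp
    have "abs_trace (2 * m) (b * (v * y)) = abs_trace m ((b * v + (b * v) ^ 2 ^ m) * y)"
      using y unfolding abs_trace_tower(2)[OF card] by (simp add: GF2_def power_mult_distrib algebra_simps)
    then have "f (v * y) + abs_trace (2 * m) (b * (v * y)) = abs_trace m (e v * y)"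
      using abs_trace_add[OF card GF2_mult[OF c y] GF2_mult[OF abs_trace_tower(1)[OF card, of "b * v"] y]]
      by (simp add: f[OF that] e_def distrib_right)
    then show ?thesis by simp
  qed
  have inner: "(\<Sum>y\<in>GF2 m - {0}. chi (abs_trace m (e v * y)))
      = 2 ^ m * of_bool (b * v + (b * v) ^ 2 ^ m = c) - 1" for v
  proof -
    have "e v = 0 \<longleftrightarrow> b * v + (b * v) ^ 2 ^ m = c"
      unfolding e_def add_eq_0_iff_CHAR_2[OF char] by auto
    then show ?thesis
      using sum_chi_abs_trace[OF card m card_GF2[OF m card] e, of v]
      by (simp add: sum_diff1 abs_trace_0[OF card])
  qed
  have "walsh (2 * m) f b = ?F 0 + (\<Sum>x\<in>UNIV - {0}. ?F x)"
    unfolding walsh_def by (rule sum.remove) auto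
  also have "?F 0 = 1"
    by (simp add: f0 abs_trace_0[OF card])
  also have "(\<Sum>x\<in>UNIV - {0}. ?F x) = (\<Sum>(v, y)\<in>?M \<times> (GF2 m - {0}). ?F (v * y))"
    using sum.reindex_bij_betw[OF polar_bij[OF card m], of ?F, symmetric]
    by (simp add: case_prod_unfold)
  also have "\<dots> = (\<Sum>v\<in>?M. \<Sum>y\<in>GF2 m - {0}. ?F (v * y))"
    by (rule sum.cartesian_product[symmetric])
  also have "\<dots> = (\<Sum>v\<in>?M. 2 ^ m * of_bool (b * v + (b * v) ^ 2 ^ m = c) - 1)"
    by (intro sum.cong refl) (subst inner[symmetric], intro sum.cong refl F)
  also have "\<dots> = 2 ^ m * real (card {v \<in> ?M. b * v + (b * v) ^ 2 ^ m = c}) - (2 ^ m + 1)"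
    by (simp add: sum_subtractf card_mu[OF card m, simplified] flip: sum_distrib_left)
      (simp add: Int_def conj_commute)
  finally show ?thesis
    by (simp add: algebra_simps)
qed

lemma card_mu_trace_eq:
  fixes b c :: "'a::finite_field"
  assumes card: "CARD('a) = 2 ^ (2 * m)" and m: "m > 0" and c: "c \<in> GF2 m" "c \<noteq> 0"
  shows "card {v \<in> mu (2 ^ m + 1). b * v + (b * v) ^ 2 ^ m = c}
    = (if abs_trace m (b ^ (2 ^ m + 1) / c\<^sup>2) = 1 then 2 else 0)"
proof (cases "b = 0")
  case True
  \<comment> \<open>The inverse substitution divides by \<open>b\<close>, so b = 0 stands apart: no
    \<open>v\<close> qualifies because \<open>c\<close> is nonzero, and the trace of 0 is 0.\<close>
  then have "{v \<in> mu (2 ^ m + 1). b * v + (b * v) ^ 2 ^ m = c} = {}"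
    using c by auto
  then show ?thesis
    using True by (simp only:) (simp add: abs_trace_0[OF card])
next
  case False
  note char = CHAR_2[OF card]
  let ?q = "2 ^ m :: nat"
  define d where "d = b ^ (?q + 1) / c\<^sup>2"
  have "b ^ (?q + 1) \<in> GF2 m"
    by (simp add: GF2_def power_mult_distrib frobenius_conjugate[OF card])
  then have d: "d \<in> GF2 m" "d \<noteq> 0"
    unfolding d_def using c False by (auto intro: GF2_divide GF2_power)
  have cq: "c ^ ?q = c"
    using c by (simp add: GF2_def)
  have "bij_betw (\<lambda>v. b * v / c) {v \<in> mu (?q + 1). b * v + (b * v) ^ ?q = c}
    {z. z ^ ?q + z = 1 \<and> z\<^sup>2 + z = d}"
  proof (rule bij_betw_byWitness[where f' = "\<lambda>z. c * z / b"])
    show "(\<lambda>v. b * v / c) ` {v \<in> mu (?q + 1). b * v + (b * v) ^ ?q = c}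
        \<subseteq> {z. z ^ ?q + z = 1 \<and> z\<^sup>2 + z = d}"
    proof (rule image_subsetI)
      fix v assume "v \<in> {v \<in> mu (?q + 1). b * v + (b * v) ^ ?q = c}"
      then have v: "v \<in> mu (?q + 1)" and tr: "b * v + (b * v) ^ ?q = c"
        by blast+
      let ?z = "b * v / c"
      have 1: "?z ^ ?q + ?z = 1"
        using tr c by (simp add: power_divide cq add.commute flip: add_divide_distrib)
      then have "?z ^ ?q = ?z + 1"
        by (metis add.assoc add.commute add_0_right add_self_CHAR_2[OF char])
      \<comment> \<open>With z^q = z + 1, the quadratic expression is the norm of z, and
        \<open>v\<close> has norm 1.\<close>
      then have "?z\<^sup>2 + ?z = ?z ^ (?q + 1)"
        by (simp add: power2_eq_square algebra_simps)
      also have "\<dots> = b ^ (?q + 1) * v ^ (?q + 1) / (c ^ ?q * c)"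
        by (simp add: power_divide power_mult_distrib mult_ac)
      also have "\<dots> = d"
        using v unfolding cq by (simp add: mu_def d_def power2_eq_square)
      finally show "?z \<in> {z. z ^ ?q + z = 1 \<and> z\<^sup>2 + z = d}"
        using 1 by blast
    qed
    show "(\<lambda>z. c * z / b) ` {z. z ^ ?q + z = 1 \<and> z\<^sup>2 + z = d}
        \<subseteq> {v \<in> mu (?q + 1). b * v + (b * v) ^ ?q = c}"
    proof (rule image_subsetI)
      fix z assume "z \<in> {z. z ^ ?q + z = 1 \<and> z\<^sup>2 + z = d}"
      then have 1: "z ^ ?q + z = 1" and z: "d = z\<^sup>2 + z"
        by auto
      have "z ^ ?q = z + 1"
        using 1 by (metis add.assoc add.commute add_0_right add_self_CHAR_2[OF char])
      then have "z ^ (?q + 1) = d"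
        by (simp add: z power2_eq_square algebra_simps)
      then have "(c * z / b) ^ (?q + 1) = c ^ ?q * c * d / b ^ (?q + 1)"
        by (simp add: power_divide power_mult_distrib)
      also have "\<dots> = 1"
        unfolding cq using c False by (simp add: d_def power2_eq_square)
      finally have "c * z / b \<in> mu (?q + 1)"
        by (simp add: mu_def)
      moreover have "c * z + (c * z) ^ ?q = c * (z ^ ?q + z)"
        by (simp add: power_mult_distrib cq algebra_simps)
      then have "b * (c * z / b) + (b * (c * z / b)) ^ ?q = c"
        using 1 False by simp
      ultimately show "c * z / b \<in> {v \<in> mu (?q + 1). b * v + (b * v) ^ ?q = c}"
        by blast
    qed
  qed (use c False in auto)
  then have "card {v \<in> mu (?q + 1). b * v + (b * v) ^ ?q = c}
      = card {z. z ^ ?q + z = 1 \<and> z\<^sup>2 + z = d}"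
    by (rule bij_betw_same_card)
  then show ?thesis
    using card_artin_schreier_conjugate[OF card m d(1)] by (simp add: d_def)
qed

text \<open>The first conjunct ensures that the sets u^i * (\<open>GF2 m\<close> - {0}) cover all
  nonzero elements, so the conditions determine \<open>f\<close> everywhere.\<close>

theorem theorem3p7:
  fixes m n q :: nat
    and \<omega> u c :: "'a::finite_field"
    and a :: "nat \<Rightarrow> 'a" and s :: "nat \<Rightarrow> nat"
    and f :: "'a \<Rightarrow> bit"
  assumes "m \<ge> 1" and "n = 2 * m" and "q = 2 ^ m"
    and "CARD('a) = q ^ 2"
    and "primitive_elem \<omega>"
    and "u = \<omega> ^ ((q - 1) * (2 ^ (n - 1) - 1))"
    and "c \<in> GF2 m - {0}"
    and "\<And>i. i \<in> {0..q} \<Longrightarrow> s i \<le> q"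
    and "\<And>i. i \<in> {0..q} \<Longrightarrow>
           a i * u powi (int i * (1 - 2 * int (s i)))
           + a i ^ q * u powi (int i * (2 * int (s i) - 1)) = c"
    and "f 0 = 0"
    and "\<And>i x. i \<in> {0..q} \<Longrightarrow> x \<in> (\<lambda>y. u ^ i * y) ` (GF2 m - {0}) \<Longrightarrow>
           f x = abs_trace n (a i * x ^ (s i * (q - 1) + 1))"
  shows "mu (q + 1) = range (\<lambda>k::nat. u ^ k)
    \<and> bent n f
    \<and> bent_dual n f = (\<lambda>x. abs_trace m (c powi (- 2) * x ^ (q + 1)) + 1)"
proof -
  note q = \<open>q = 2 ^ m\<close> and n = \<open>n = 2 * m\<close>
  have m: "m > 0"
    using \<open>m \<ge> 1\<close> by simp
  have card: "CARD('a) = 2 ^ (2 * m)"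
    using assms(4) by (simp add: q mult.commute flip: power_mult)
  have c: "c \<in> GF2 m" "c \<noteq> 0"
    using assms(7) by auto
  have range: "mu (q + 1) = range (\<lambda>k::nat. u ^ k)"
    using range_power_eq_mu[OF card m assms(5)] assms(6) by (simp add: q n)
  have "u \<in> mu (q + 1)"
    using range by (metis power_one_right rangeI)
  then have u: "u ^ (q + 1) = 1" "u \<noteq> 0"
    by (auto simp: mu_def)
  have q1: "q \<ge> 1"
    by (simp add: q)
  have uq: "u ^ q = u powi (-1)"
    using u by (simp add: field_simps power_int_minus)
  have f: "f (v * y) = abs_trace m (c * y)" if v: "v \<in> mu (2 ^ m + 1)" and y: "y \<in> GF2 m - {0}" for v y
  proof -
    obtain k where "v = u ^ k"
      using v range q by auto
    \<comment> \<open>Reducing \<open>k\<close> modulo q + 1 gives an index in the range where the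
      hypotheses on \<open>a\<close> and \<open>s\<close> apply.\<close>
    also have "u ^ k = u ^ (k mod (q + 1) + (q + 1) * (k div (q + 1)))"
      by (simp only: mod_mult_div_eq)
    also have "\<dots> = u ^ (k mod (q + 1))"
      unfolding power_add[of u "k mod (q + 1)"] power_mult u by simp
    finally obtain i where v: "v = u ^ i" and i: "i \<in> {0..q}"
      by (metis mod_less_divisor Suc_eq_plus1 zero_less_Suc less_Suc_eq_le atLeast0AtMost atMost_iff)
    let ?r = "s i * (q - 1) + 1" and ?t = "int i * (1 - 2 * int (s i))"
    have yq: "y ^ q = y"
      using y by (simp add: GF2_def q)
    then have "y ^ (q - 1) = 1"
      using y q1 by (metis DiffE insertI1 mult_cancel_right1 power_eq_if mult.commute not_one_le_zero)
    then have yr: "y ^ ?r = y"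
      by (simp only: power_add power_mult mult.commute[of "s i"]) simp
    \<comment> \<open>As u^q is the inverse of \<open>u\<close>, u^(q-1) is u^(-2), which turns the
      exponent s(q-1) + 1 into 1 - 2s.\<close>
    have "u ^ ?r = (u ^ q * u powi (-1)) ^ s i * u"
    proof -
      have "u ^ (q - 1) = u ^ q * u powi (-1)"
        using u q1 by (simp add: power_diff power_int_minus divide_inverse)
      then show ?thesis
        by (simp only: power_add power_mult mult.commute[of "s i"]) simp
    qed
    also have "\<dots> = u powi (1 - 2 * int (s i))"
      unfolding uq using u
      by (simp add: power_int_diff power_int_mult power_int_minus power2_eq_square
          power_mult_distrib field_simps)
    finally have vr: "v ^ ?r = u powi ?t"
      unfolding v by (metis power_mult mult.commute power_int_mult power_int_of_nat)
    have "f (v * y) = abs_trace n (a i * (v * y) ^ ?r)"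
      using assms(11)[OF i, of "v * y"] y unfolding v by blast
    then have fx: "f (v * y) = abs_trace n (a i * u powi ?t * y)"
      unfolding power_mult_distrib vr yr by (simp only: mult.assoc)
    have "(u powi ?t) ^ q = u powi (int i * (2 * int (s i) - 1))"
    proof -
      have "(u powi ?t) ^ q = (u ^ q) powi ?t"
        by (metis power_int_mult power_int_of_nat mult.commute)
      also have "\<dots> = u powi (int i * (2 * int (s i) - 1))"
        unfolding uq power_int_mult[symmetric] by (simp add: algebra_simps)
      finally show ?thesis .
    qed
    \<comment> \<open>The two summands of the hypothesis are conjugate, so it prescribes the
      relative trace \<open>c\<close>; \<open>y\<close> is fixed by conjugation and factors
      out.\<close>
    then have "a i * u powi ?t * y + (a i * u powi ?t * y) ^ q = c * y"
      using assms(9)[OF i] yq by (simp add: power_mult_distrib flip: distrib_right)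
    then show ?thesis
      using fx abs_trace_tower(2)[OF card, of "a i * u powi ?t * y"] by (simp add: n q)
  qed
  \<comment> \<open>The added 1 matches the sign: trace 1 gives N = 2 and a positive value, trace 0
    gives N = 0 and a negative one.\<close>
  define g where "g b = abs_trace m (c powi (- 2) * b ^ (q + 1)) + 1" for b
  have sqrt: "2 powr (real n / 2) = 2 ^ m"
    by (simp add: n powr_realpow)
  have walsh: "walsh n f b = 2 powr (n / 2) * chi (g b)" for b
  proof -
    have "walsh n f b = 2 ^ m * (if abs_trace m (b ^ (q + 1) / c\<^sup>2) = 1 then 1 else - 1)"
      using walsh_polar[OF card m c(1) \<open>f 0 = 0\<close> f, of b] card_mu_trace_eq[OF card m c, of b]
      by (simp add: n q)
    moreover have "c powi (- 2) * b ^ (q + 1) = b ^ (q + 1) / c\<^sup>2"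
      by (simp add: power_int_minus field_simps)
    ultimately show ?thesis
      unfolding sqrt g_def by (cases "abs_trace m (b ^ (q + 1) / c\<^sup>2)") simp_all
  qed
  have "\<bar>chi t\<bar> = 1" for t
    by (cases t) auto
  then have bent: "bent n f"
    by (simp add: bent_def walsh abs_mult)
  then have "chi (bent_dual n f b) = chi (g b)" for b
    using walsh_bent_dual[OF bent, of b] walsh[of b] by simp
  then have "bent_dual n f = g"
    by (simp add: chi_eq_iff fun_eq_iff)
  then show ?thesis
    using range bent by (simp add: g_def fun_eq_iff)
qed

end
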